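(* Let $d\ge1$ and $r>0$. Define, for integers $n\ge2$, $$\kappa_{d,r}(n)=\begin{cases}\lambda_{d,r}(n)&\text{if }r<d,\\ (\log n)^{d-1}\lambda_{d,r}(n)&\text{if }r=d,\\ n^{r-d}\lambda_{d,r}(n)&\text{if }r>d.\end{cases}$$ Then $\kappa_{d,r}(n)$ is bounded away from $0$ and $\infty$: there exist constants $0<c\le C<\infty$ (depending on $d,r$) such that $c\le\kappa_{d,r}(n)\le C$ for all $n\ge2$.
   Context: Let $D_n=\{y\in\mathbb{Z}^d:|y|_\infty\le n\}$, $\partial D_n=\{y\in\mathbb{Z}^d:|y|_\infty=n\}$, and let $E_n$ be the set of undirected nearest-neighbor edges $\langle x,y\rangle$ with $x,y\in D_n$, $|x-y|_1=1$. The discrete $r$-capacity is $$\lambda_{d,r}(n)=\inf_{f:D_n\to\mathbb{R}}\Big\{\sum_{\langle x,y\rangle\in E_n}|f(x)-f(y)|^r\ :\ f(x)\ge1\ \forall x\in\partial D_n,\ f(0)=0\Big\}.$$ *)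

theory Defs
  imports "HOL-Analysis.Analysis"
begin

text \<open>The lattice of dimension d is \<^typ>\<open>int ^ 'd\<close> with d = \<^term>\<open>CARD('d)\<close>; since types are
  nonempty, d is at least 1, and every positive d arises as the cardinality of some finite type.\<close>

definition sup_norm :: "int ^ 'd::finite \<Rightarrow> int" where
  "sup_norm x = Max (range (\<lambda>i. \<bar>x $ i\<bar>))"

definition l1_norm :: "int ^ 'd::finite \<Rightarrow> int" where
  "l1_norm x = (\<Sum>i\<in>UNIV. \<bar>x $ i\<bar>)"

definition box_D :: "nat \<Rightarrow> (int ^ 'd::finite) set" where
  "box_D n = {y. sup_norm y \<le> int n}"

definition bdry_D :: "nat \<Rightarrow> (int ^ 'd::finite) set" where
  "bdry_D n = {y. sup_norm y = int n}"

text \<open>An undirected edge is the two-element set of its endpoints, so each edge is counted once.\<close>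

definition edges_D :: "nat \<Rightarrow> (int ^ 'd::finite) set set" where
  "edges_D n = {{x, y} | x y. x \<in> box_D n \<and> y \<in> box_D n \<and> l1_norm (x - y) = 1}"

definition edge_diff :: "('a \<Rightarrow> real) \<Rightarrow> 'a set \<Rightarrow> real" where
  "edge_diff f e = (THE t. \<exists>x y. e = {x, y} \<and> t = \<bar>f x - f y\<bar>)"

lemma edge_diff_doubleton: "edge_diff f {x, y} = \<bar>f x - f y\<bar>"
  unfolding edge_diff_def
  by (rule the_equality) (auto simp: doubleton_eq_iff abs_minus_commute)

text \<open>Note that \<^term>\<open>0 powr r = 0\<close>, as it should be for r > 0.\<close>

definition energy :: "real \<Rightarrow> nat \<Rightarrow> (int ^ 'd::finite \<Rightarrow> real) \<Rightarrow> real" where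
  "energy r n f = (\<Sum>e\<in>edges_D n. edge_diff f e powr r)"

text \<open>Functions on the box are represented by functions on the whole lattice: neither the
  constraints nor the energy depend on values outside the box.\<close>

definition admissible :: "nat \<Rightarrow> (int ^ 'd::finite \<Rightarrow> real) set" where
  "admissible n = {f. (\<forall>x\<in>bdry_D n. f x \<ge> 1) \<and> f 0 = 0}"

definition capacity :: "'d::finite itself \<Rightarrow> real \<Rightarrow> nat \<Rightarrow> real" where
  "capacity _ r n = (INF f \<in> (admissible n :: (int ^ 'd \<Rightarrow> real) set). energy r n f)"

definition kappa :: "'d::finite itself \<Rightarrow> real \<Rightarrow> nat \<Rightarrow> real" where
  "kappa T r n =
     (if r < real CARD('d) then capacity T r n
      else if r = real CARD('d) then ln (real n) ^ (CARD('d) - 1) * capacity T r n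
      else real n powr (r - real CARD('d)) * capacity T r n)"

text \<open>The sum in \<^const>\<open>energy\<close> is finite and the infimum in \<^const>\<open>capacity\<close> is over a nonempty
  set of values bounded below, so neither takes a junk value.\<close>

lemma finite_box_D: "finite (box_D n :: (int ^ 'd::finite) set)"
proof (rule finite_subset)
  show "box_D n \<subseteq> vec_lambda ` (PiE (UNIV :: 'd set) (\<lambda>_. {- int n..int n}))"
  proof
    fix x :: "int ^ 'd" assume "x \<in> box_D n"
    then have "\<bar>x $ i\<bar> \<le> int n" for i
      by (auto simp: box_D_def sup_norm_def)
    then have "vec_nth x \<in> PiE UNIV (\<lambda>_. {- int n..int n})"
      by (auto simp: abs_le_iff minus_le_iff)
    then show "x \<in> vec_lambda ` (PiE UNIV (\<lambda>_. {- int n..int n}))"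
      by (metis image_eqI vec_nth_inverse)
  qed
  show "finite (vec_lambda ` (PiE (UNIV :: 'd set) (\<lambda>_. {- int n..int n})))"
    by (intro finite_imageI finite_PiE) auto
qed

lemma finite_edges_D: "finite (edges_D n :: (int ^ 'd::finite) set set)"
  by (rule finite_subset[of _ "Pow (box_D n)"]) (auto simp: edges_D_def finite_box_D)

lemma energy_nonneg: "energy r n f \<ge> 0"
  by (simp add: energy_def sum_nonneg)

lemma admissible_nonempty: "n \<ge> 1 \<Longrightarrow> (admissible n :: (int ^ 'd::finite \<Rightarrow> real) set) \<noteq> {}"
proof -
  assume "n \<ge> 1"
  then have "(\<lambda>x. if x = 0 then 0 else 1) \<in> (admissible n :: (int ^ 'd \<Rightarrow> real) set)"
    by (auto simp: admissible_def bdry_D_def sup_norm_def)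
  then show ?thesis by blast
qed

end

theory Submission
  imports Defs
begin

text \<open>Upper bounds come from radial test functions \<open>\<phi> (sup_norm x)\<close>, with \<open>\<phi> m\<close> equal to \<open>min m 1\<close>,
  \<open>ln (m + 1) / ln (n + 1)\<close> or \<open>m / n\<close> according to whether r is below, equal to or above d.
  For the lower bound, a Polya urn provides a unit flow from the origin to the boundary, inside
  the positive orthant, whose size at distance k is of order \<open>k powr (1 - d)\<close>. Testing it
  against the gradient of an admissible f gives at least 1. For \<open>r > 1\<close>, Hoelder's inequality
  with conjugate exponent q bounds the energy of f from below by the power \<open>1 - r\<close> of the
  q-energy of the flow, which is of the order of the sum over \<open>k \<le> d * n\<close> of
  \<open>k powr - ((d - 1) / (r - 1))\<close>; this sum is bounded, logarithmic or polynomial in the three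
  regimes. For \<open>r \<le> 1\<close> the flow already forces energy at least 1.\<close>

section \<open>Sums of powers and Hoelder's inequality\<close>

text \<open>Both families are scaled to norm 1, where Young's inequality, applied termwise, sums to
  \<open>1 / p + 1 / q = 1\<close>. If one of the norms vanishes, so does the left side.\<close>

lemma Holder_sum:
  fixes a b :: "'a \<Rightarrow> real"
  assumes "p > 1" "q > 1" "1 / p + 1 / q = 1"
    and "\<And>x. x \<in> A \<Longrightarrow> a x \<ge> 0" "\<And>x. x \<in> A \<Longrightarrow> b x \<ge> 0"
  shows "(\<Sum>x\<in>A. a x * b x) \<le> (\<Sum>x\<in>A. a x powr p) powr (1 / p) * (\<Sum>x\<in>A. b x powr q) powr (1 / q)"
proof (cases "finite A")
  \<comment> \<open>Over an infinite set all three sums are 0 by convention.\<close>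
  case False
  then show ?thesis by simp
next
  case fin: True
  define S where "S = (\<Sum>x\<in>A. a x powr p)"
  define T where "T = (\<Sum>x\<in>A. b x powr q)"
  have nn: "S \<ge> 0" "T \<ge> 0"
    by (auto simp: S_def T_def intro: sum_nonneg)
  show ?thesis
  proof (cases "S = 0 \<or> T = 0")
    case True
    then have "(\<forall>x\<in>A. a x = 0) \<or> (\<forall>x\<in>A. b x = 0)"
      by (auto simp: S_def T_def sum_nonneg_eq_0_iff[OF fin])
    then have "(\<Sum>x\<in>A. a x * b x) = 0"
      by (auto intro: sum.neutral)
    then show ?thesis by simp
  next
    case False
    then have pos: "S > 0" "T > 0" using nn by auto
    define u where "u x = a x / S powr (1 / p)" for x
    define v where "v x = b x / T powr (1 / q)" for x
    have up: "u x powr p = a x powr p / S" if "x \<in> A" for x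
      using that assms pos by (simp add: u_def powr_divide powr_powr)
    have vq: "v x powr q = b x powr q / T" if "x \<in> A" for x
      using that assms pos by (simp add: v_def powr_divide powr_powr)
    have "(\<Sum>x\<in>A. u x * v x) \<le> (\<Sum>x\<in>A. u x powr p / p + v x powr q / q)"
      using assms by (intro sum_mono Youngs_inequality) (auto simp: u_def v_def)
    also have "\<dots> = (\<Sum>x\<in>A. a x powr p / S / p + b x powr q / T / q)"
      using up vq by (intro sum.cong) auto
    also have "\<dots> = S / S / p + T / T / q"
      by (simp add: sum.distrib S_def T_def flip: sum_divide_distrib)
    also have "\<dots> = 1" using pos assms by simp
    finally have "(\<Sum>x\<in>A. u x * v x) \<le> 1" .
    moreover have "(\<Sum>x\<in>A. u x * v x) = (\<Sum>x\<in>A. a x * b x) / (S powr (1 / p) * T powr (1 / q))"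
      by (simp add: u_def v_def sum_divide_distrib)
    ultimately show ?thesis
      using pos by (simp add: divide_le_eq flip: S_def T_def)
  qed
qed

section \<open>Partial sums of the series of powers, in three ranges of the exponent\<close>

definition power_sum :: "real \<Rightarrow> nat \<Rightarrow> real" where
  "power_sum s N = (\<Sum>k<N. real (Suc k) powr - s)"

lemma power_sum_pos: "N > 0 \<Longrightarrow> power_sum s N > 0"
  unfolding power_sum_def by (intro sum_pos) auto

lemma power_sum_bounded:
  assumes "s > 1"
  obtains B where "B > 0" "\<And>N. power_sum s N \<le> B"
proof
  have sm: "summable (\<lambda>k. real (Suc k) powr - s)"
    using assms by (subst summable_Suc_iff) (simp add: summable_real_powr_iff)
  show "power_sum s N \<le> (\<Sum>k. real (Suc k) powr - s)" for N
    unfolding power_sum_def using sm by (intro sum_le_suminf) auto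
  show "0 < (\<Sum>k. real (Suc k) powr - s)"
    using sm by (intro suminf_pos) auto
qed

text \<open>Each new term \<open>1 / (N + 1)\<close> is at most the increment of \<open>ln\<close>
  from N to \<open>N + 1\<close>.\<close>

lemma power_sum_1_le:
  assumes "N > 0"
  shows "power_sum 1 N \<le> 1 + ln (real N)"
  using assms
proof (induction N rule: nat_induct_non_zero)
  case 1
  then show ?case by (simp add: power_sum_def)
next
  case (Suc N)
  have "power_sum 1 (Suc N) = power_sum 1 N + inverse (real N + 1)"
    by (simp add: power_sum_def powr_minus add.commute)
  moreover have "inverse (real N + 1) \<le> ln (real N + 1) - ln (real N)"
    using ln_inverse_approx_le[of "real N" 1] Suc.hyps ln_diff_le[of "real N" "real N + 1"]
    by (simp add: field_simps)
  ultimately show ?case using Suc.IH by (simp add: add.commute)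
qed

text \<open>Each term \<open>M powr - s\<close> is at most the increment of
  \<open>t powr (1 - s) / (1 - s)\<close> between \<open>t = M - 1\<close> and \<open>t = M\<close>,
  and these increments telescope.\<close>

lemma power_sum_le_powr:
  assumes "0 \<le> s" "s < 1"
  shows "power_sum s N \<le> real N powr (1 - s) / (1 - s)"
proof (induction N)
  case 0
  then show ?case by (simp add: power_sum_def)
next
  case (Suc N)
  define M where "M = real N + 1"
  have "(1 - s) * M powr - s \<le> M powr (1 - s) - real N powr (1 - s)"
  proof (cases "N = 0")
    case True
    then show ?thesis using assms by (simp add: M_def)
  next
    case False
    have M: "M > 0" by (simp add: M_def)
    \<comment> \<open>The weighted arithmetic-geometric mean inequality for N and
      \<open>M = N + 1\<close>, with weights \<open>1 - s\<close> and s, stands in for an integral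
      comparison; dividing by \<open>M powr s\<close> gives the increment bound.\<close>
    have "real N powr (1 - s) * M powr s \<le> (1 - s) * real N + s * M"
      using assms False M by (intro Youngs_inequality_0) auto
    also have "\<dots> = M - (1 - s)" by (simp add: M_def algebra_simps)
    finally have "real N powr (1 - s) * M powr s * M powr - s \<le> (M - (1 - s)) * M powr - s"
      by (intro mult_right_mono) auto
    moreover have "real N powr (1 - s) * M powr s * M powr - s = real N powr (1 - s)"
      using M by (simp add: powr_minus)
    moreover have "M * M powr - s = M powr (1 - s)"
      using M by (simp add: powr_diff powr_minus divide_inverse)
    ultimately show ?thesis by (simp add: left_diff_distrib)
  qed
  then have "M powr - s \<le> (M powr (1 - s) - real N powr (1 - s)) / (1 - s)"
    using assms by (simp add: pos_le_divide_eq mult.commute)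
  moreover have "power_sum s (Suc N) = power_sum s N + M powr - s"
    by (simp add: power_sum_def M_def add.commute)
  ultimately show ?case using Suc.IH by (simp add: M_def diff_divide_distrib add.commute)
qed

section \<open>Lattice points\<close>

text \<open>Forgetting coordinate i is injective on A, since that coordinate is recovered from the
  others, and it leaves functions from \<open>d - 1\<close> coordinates to B. Both the faces of a
  cube and the levels of the orthant are counted this way.\<close>

lemma card_determined_coordinate:
  fixes A :: "('a ^ 'd::finite) set"
  assumes "finite B" and "\<And>x j. x \<in> A \<Longrightarrow> x $ j \<in> B"
    and det: "\<And>x y. x \<in> A \<Longrightarrow> y \<in> A \<Longrightarrow> (\<And>j. j \<noteq> i \<Longrightarrow> x $ j = y $ j) \<Longrightarrow> x $ i = y $ i"
  shows "card A \<le> card B ^ (CARD('d) - 1)"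
proof -
  let ?h = "\<lambda>x. restrict (vec_nth x) (UNIV - {i})"
  have "inj_on ?h A"
  proof (rule inj_onI)
    fix x y assume xy: "x \<in> A" "y \<in> A" "?h x = ?h y"
    then have eq: "x $ j = y $ j" if "j \<noteq> i" for j
      using that by (metis DiffI UNIV_I empty_iff insert_iff restrict_apply')
    then have "x $ i = y $ i" using det xy by blast
    with eq show "x = y" by (metis vec_eq_iff)
  qed
  moreover have "?h ` A \<subseteq> PiE (UNIV - {i}) (\<lambda>_. B)"
    using assms(2) by (auto split: if_splits)
  moreover have "finite (PiE (UNIV - {i}) (\<lambda>_. B))"
    using assms(1) by (intro finite_PiE) auto
  ultimately have "card A \<le> card (PiE (UNIV - {i}) (\<lambda>_. B))"
    by (meson card_inj_on_le)
  then show ?thesis by (simp add: card_PiE card_Diff_singleton)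
qed

lemma sup_norm_le_iff: "sup_norm x \<le> k \<longleftrightarrow> (\<forall>i. \<bar>x $ i\<bar> \<le> k)"
  by (auto simp: sup_norm_def)

lemma sup_norm_attained: "\<exists>i. sup_norm x = \<bar>x $ i\<bar>"
proof -
  have "sup_norm x \<in> range (\<lambda>i. \<bar>x $ i\<bar>)"
    unfolding sup_norm_def by (intro Max_in) auto
  then show ?thesis by auto
qed

lemma sup_norm_nonneg: "sup_norm x \<ge> 0"
  using sup_norm_attained[of x] by auto

lemma sup_norm_0 [simp]: "sup_norm 0 = 0"
  using sup_norm_attained[of 0] by auto

lemma sup_norm_add_axis: "\<bar>sup_norm (x + axis i 1) - sup_norm x\<bar> \<le> 1"
proof -
  have nth: "\<bar>(x + axis i 1) $ j - x $ j\<bar> \<le> 1" for j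
    by (simp add: axis_def)
  have le: "\<bar>x $ j\<bar> \<le> sup_norm x" "\<bar>(x + axis i 1) $ j\<bar> \<le> sup_norm (x + axis i 1)" for j
    using sup_norm_le_iff by blast+
  have "\<bar>(x + axis i 1) $ j\<bar> \<le> sup_norm x + 1" "\<bar>x $ j\<bar> \<le> sup_norm (x + axis i 1) + 1" for j
    using nth[of j] le[of j] by linarith+
  then have "sup_norm (x + axis i 1) \<le> sup_norm x + 1" "sup_norm x \<le> sup_norm (x + axis i 1) + 1"
    using sup_norm_le_iff by blast+
  then show ?thesis by linarith
qed

text \<open>Some coordinate attains the norm, so the sphere is covered by \<open>2 * d\<close>
  faces, each with one coordinate fixed at m or \<open>- m\<close> and the others between
  \<open>- m\<close> and m.\<close>

lemma card_sphere_le: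
  "card {x :: int ^ 'd::finite. sup_norm x = int m} \<le> 2 * CARD('d) * (2 * m + 1) ^ (CARD('d) - 1)"
proof -
  define F where "F = (\<lambda>(i, c). {x :: int ^ 'd. sup_norm x = int m \<and> x $ i = c})"
  let ?K = "(UNIV :: 'd set) \<times> {int m, - int m}"
  have "x \<in> (\<Union>p\<in>?K. F p)" if m: "sup_norm x = int m" for x
  proof -
    obtain i where "\<bar>x $ i\<bar> = int m" using m sup_norm_attained[of x] by metis
    then have "(i, x $ i) \<in> ?K" "x \<in> F (i, x $ i)"
      using m by (auto simp: F_def abs_if split: if_splits)
    then show ?thesis by blast
  qed
  then have sub: "{x :: int ^ 'd. sup_norm x = int m} \<subseteq> (\<Union>p\<in>?K. F p)"
    by blast
  have "F p \<subseteq> box_D m" for p by (auto simp: F_def box_D_def split: prod.splits)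
  then have fin: "finite (F p)" for p by (meson finite_box_D finite_subset)
  have F: "card (F p) \<le> (2 * m + 1) ^ (CARD('d) - 1)" for p
  proof -
    obtain i c where p: "p = (i, c)" by (cases p)
    have "card (F p) \<le> card {- int m..int m} ^ (CARD('d) - 1)"
    proof (rule card_determined_coordinate[where i = i])
      show "x $ j \<in> {- int m..int m}" if "x \<in> F p" for x j
      proof -
        have "\<bar>x $ j\<bar> \<le> int m"
          using that sup_norm_le_iff[of x "int m"] by (simp add: F_def p)
        then show ?thesis by auto
      qed
    qed (auto simp: F_def p)
    then show ?thesis by (simp add: nat_add_distrib nat_mult_distrib)
  qed
  have "card {x :: int ^ 'd. sup_norm x = int m} \<le> card (\<Union>p\<in>?K. F p)"
    using sub fin by (intro card_mono) auto
  also have "\<dots> \<le> (\<Sum>p\<in>?K. card (F p))"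
    by (intro card_UN_le) auto
  also have "\<dots> \<le> (\<Sum>p\<in>?K. (2 * m + 1) ^ (CARD('d) - 1))"
    by (intro sum_mono F)
  also have "\<dots> = card ?K * (2 * m + 1) ^ (CARD('d) - 1)"
    by simp
  \<comment> \<open>Only an inequality, because for \<open>m = 0\<close> the two signs
    coincide.\<close>
  also have "card ?K \<le> 2 * CARD('d)"
    by (simp add: card_cartesian_product card_insert_if)
  finally show ?thesis by simp
qed

section \<open>Orienting the edges\<close>

lemma l1_norm_eq_1D:
  fixes z :: "int ^ 'd::finite"
  assumes "l1_norm z = 1"
  shows "\<exists>i. z = axis i 1 \<or> z = - axis i 1"
proof -
  obtain i where i: "z $ i \<noteq> 0"
    using assms unfolding l1_norm_def by (metis abs_zero sum.neutral zero_neq_one)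
  have eq: "(\<Sum>j\<in>UNIV. \<bar>z $ j\<bar>) = \<bar>z $ i\<bar> + (\<Sum>j\<in>UNIV - {i}. \<bar>z $ j\<bar>)"
    by (simp add: sum.remove)
  moreover have "(\<Sum>j\<in>UNIV - {i}. \<bar>z $ j\<bar>) \<ge> 0" by (intro sum_nonneg) auto
  ultimately have "\<bar>z $ i\<bar> = 1" "(\<Sum>j\<in>UNIV - {i}. \<bar>z $ j\<bar>) = 0"
    using assms i unfolding l1_norm_def by linarith+
  then have "\<bar>z $ i\<bar> = 1" "\<And>j. j \<noteq> i \<Longrightarrow> z $ j = 0"
    by (auto simp: sum_nonneg_eq_0_iff)
  then show ?thesis
    by (intro exI[of _ i]) (auto simp: vec_eq_iff axis_def abs_if split: if_splits)
qed

lemma l1_norm_axis [simp]: "l1_norm (axis i 1) = 1" "l1_norm (- axis i 1) = 1"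
  by (simp_all add: l1_norm_def axis_def if_distrib cong: if_cong)

text \<open>Every edge is oriented so that it runs in a positive coordinate direction.\<close>

lemma edges_D_eq:
  "edges_D n = (\<lambda>(x, i). {x, x + axis i 1}) ` {(x, i). x \<in> box_D n \<and> x + axis i 1 \<in> box_D n}"
  (is "?L = ?R")
proof
  show "?L \<subseteq> ?R"
  proof
    fix e assume "e \<in> ?L"
    then obtain x y where e: "e = {x, y}" "x \<in> box_D n" "y \<in> box_D n" "l1_norm (x - y) = 1"
      by (auto simp: edges_D_def)
    then obtain i where "x - y = axis i 1 \<or> x - y = - axis i 1"
      using l1_norm_eq_1D by blast
    then have "x = y + axis i 1 \<or> y = x + axis i 1"
      by (auto simp: algebra_simps)
    with e show "e \<in> ?R" by (auto simp: insert_commute)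
  qed
  show "?R \<subseteq> ?L"
  proof
    fix e assume "e \<in> ?R"
    then obtain x i where "e = {x, x + axis i 1}" "x \<in> box_D n" "x + axis i 1 \<in> box_D n" by auto
    moreover have "l1_norm (x - (x + axis i 1)) = 1" by simp
    ultimately show "e \<in> ?L" unfolding edges_D_def by blast
  qed
qed

lemma inj_axis_edge: "inj (\<lambda>(x :: int ^ 'd::finite, i). {x, x + axis i 1})"
proof -
  \<comment> \<open>Equal edges with swapped endpoints would return to the start after two positive
    steps, yet coordinate i has grown.\<close>
  have False if "x + axis i 1 + axis j 1 = x" for x :: "int ^ 'd" and i j
  proof -
    have "(x + axis i 1 + axis j 1) $ i = x $ i" using that by metis
    then show False by (simp add: axis_def split: if_splits)
  qed
  then show ?thesis
    by (auto simp: inj_def doubleton_eq_iff axis_eq_axis)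
qed

text \<open>The positive orientation of an edge is unique, so the energy can be summed over pairs of
  a point and a direction, without \<open>edge_diff\<close>.\<close>

lemma energy_eq:
  "energy r n f = (\<Sum>(x, i) | x \<in> box_D n \<and> x + axis i 1 \<in> box_D n. \<bar>f (x + axis i 1) - f x\<bar> powr r)"
proof -
  have "inj_on (\<lambda>(x :: int ^ 'a, i). {x, x + axis i 1}) S" for S
    using inj_axis_edge inj_on_subset by blast
  then show ?thesis
    unfolding energy_def edges_D_eq
    by (subst sum.reindex)
       (auto simp: edge_diff_doubleton abs_minus_commute split_def intro!: sum.cong)
qed

section \<open>Upper bound: radial test functions\<close>

text \<open>An edge is charged to its lower endpoint x. The other end has radius larger by one,
  equal or smaller by one, so g at the radius of x must dominate the increments of
  \<open>\<phi>\<close> on both sides. The factor \<open>2 * d ^ 2\<close> collects the d directions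
  and the \<open>2 * d\<close> faces of a sphere.\<close>

lemma energy_radial_le:
  fixes \<phi> g :: "nat \<Rightarrow> real"
  assumes "r > 0" and g: "\<And>m. \<bar>\<phi> (Suc m) - \<phi> m\<bar> \<le> g m" "\<And>m. \<bar>\<phi> (Suc m) - \<phi> m\<bar> \<le> g (Suc m)"
  shows "energy r n (\<lambda>x :: int ^ 'd::finite. \<phi> (nat (sup_norm x)))
    \<le> (\<Sum>m\<le>n. 2 * real CARD('d) ^ 2 * (2 * real m + 1) ^ (CARD('d) - 1) * g m powr r)"
proof -
  let ?f = "\<lambda>x :: int ^ 'd. \<phi> (nat (sup_norm x))" and ?d = "CARD('d)"
  have diff: "\<bar>?f (x + axis i 1) - ?f x\<bar> \<le> g (nat (sup_norm x))" for x i
  proof -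
    define a b where "a = nat (sup_norm x)" and "b = nat (sup_norm (x + axis i 1))"
    have "a = b \<or> b = Suc a \<or> a = Suc b"
      using sup_norm_add_axis[of x i] sup_norm_nonneg[of x] sup_norm_nonneg[of "x + axis i 1"]
      unfolding a_def b_def by linarith
    then have "\<bar>\<phi> b - \<phi> a\<bar> \<le> g a"
      using g(1)[of a] g(2)[of b] by (auto simp: abs_minus_commute intro: order_trans[OF abs_ge_zero])
    then show ?thesis by (simp add: a_def b_def)
  qed
  have "energy r n ?f \<le> (\<Sum>(x, i)\<in>box_D n \<times> UNIV. \<bar>?f (x + axis i 1) - ?f x\<bar> powr r)"
    unfolding energy_eq by (intro sum_mono2) (auto simp: finite_box_D)
  also have "\<dots> \<le> (\<Sum>(x :: int ^ 'd, i :: 'd)\<in>box_D n \<times> UNIV. g (nat (sup_norm x)) powr r)"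
    using diff \<open>r > 0\<close> by (intro sum_mono) (auto intro!: powr_mono2)
  also have "\<dots> = (\<Sum>x\<in>(box_D n :: (int ^ 'd) set). real ?d * g (nat (sup_norm x)) powr r)"
    by (simp add: sum.cartesian_product[symmetric])
  also have "\<dots> = (\<Sum>m\<le>n. \<Sum>x | x \<in> (box_D n :: (int ^ 'd) set) \<and> nat (sup_norm x) = m.
                     real ?d * g (nat (sup_norm x)) powr r)"
    by (subst sum.group) (auto simp: finite_box_D, auto simp: box_D_def)
  also have "\<dots> \<le> (\<Sum>m\<le>n. 2 * real ?d ^ 2 * (2 * real m + 1) ^ (?d - 1) * g m powr r)"
  proof (rule sum_mono)
    fix m assume m: "m \<in> {..n}"
    have "{x. x \<in> (box_D n :: (int ^ 'd) set) \<and> nat (sup_norm x) = m} = {x. sup_norm x = int m}"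
      using m sup_norm_nonneg by (auto simp: box_D_def)
    then have "(\<Sum>x | x \<in> (box_D n :: (int ^ 'd) set) \<and> nat (sup_norm x) = m.
                 real ?d * g (nat (sup_norm x)) powr r)
        = real (card {x :: int ^ 'd. sup_norm x = int m}) * (real ?d * g m powr r)"
      by simp
    also have "\<dots> \<le> real (2 * ?d * (2 * m + 1) ^ (?d - 1)) * (real ?d * g m powr r)"
      by (intro mult_right_mono of_nat_mono card_sphere_le) simp
    finally show "(\<Sum>x | x \<in> (box_D n :: (int ^ 'd) set) \<and> nat (sup_norm x) = m.
                 real ?d * g (nat (sup_norm x)) powr r)
        \<le> 2 * real ?d ^ 2 * (2 * real m + 1) ^ (?d - 1) * g m powr r"
      by (simp add: power2_eq_square mult_ac add.commute)
  qed
  finally show ?thesis .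
qed

section \<open>Capacity bounds from three radial profiles\<close>

lemma capacity_le_energy:
  assumes "f \<in> (admissible n :: (int ^ 'd::finite \<Rightarrow> real) set)"
  shows "capacity TYPE('d) r n \<le> energy r n f"
  unfolding capacity_def using assms
  by (intro cINF_lower bdd_belowI[of _ 0]) (auto simp: energy_nonneg)

lemma capacity_radial_le:
  fixes \<phi> g :: "nat \<Rightarrow> real"
  assumes "r > 0" and g: "\<And>m. \<bar>\<phi> (Suc m) - \<phi> m\<bar> \<le> g m" "\<And>m. \<bar>\<phi> (Suc m) - \<phi> m\<bar> \<le> g (Suc m)"
    and "\<phi> 0 = 0" "\<phi> n \<ge> 1"
  shows "capacity TYPE('d::finite) r n
    \<le> (\<Sum>m\<le>n. 2 * real CARD('d) ^ 2 * (2 * real m + 1) ^ (CARD('d) - 1) * g m powr r)"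
proof -
  have "(\<lambda>x. \<phi> (nat (sup_norm x))) \<in> (admissible n :: (int ^ 'd \<Rightarrow> real) set)"
    using assms by (simp add: admissible_def bdry_D_def)
  from capacity_le_energy[OF this] energy_radial_le[of r \<phi> g n, where 'd = 'd] assms
  show ?thesis by (meson order_trans)
qed

lemma capacity_le_bounded:
  assumes "r > 0" "n \<ge> 1"
  shows "capacity TYPE('d::finite) r n \<le> 2 * real CARD('d) ^ 2 * (1 + 3 ^ (CARD('d) - 1))"
proof -
  let ?d = "CARD('d)"
  \<comment> \<open>The only nonzero increment of the profile lies between radii 0 and 1, and g has
    to dominate it at both.\<close>
  define g :: "nat \<Rightarrow> real" where "g m = (if m \<le> 1 then 1 else 0)" for m
  have "capacity TYPE('d) r n \<le> (\<Sum>m\<le>n. 2 * real ?d ^ 2 * (2 * real m + 1) ^ (?d - 1) * g m powr r)"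
    using assms by (intro capacity_radial_le[where \<phi> = "\<lambda>m. real (min m 1)"]) (auto simp: g_def)
  also have "\<dots> = (\<Sum>m\<le>1. 2 * real ?d ^ 2 * (2 * real m + 1) ^ (?d - 1) * g m powr r)"
    using assms by (intro sum.mono_neutral_right) (auto simp: g_def)
  also have "\<dots> = 2 * real ?d ^ 2 * (1 + 3 ^ (?d - 1))"
    by (simp add: g_def algebra_simps)
  finally show ?thesis .
qed

text \<open>The linear profile has slope \<open>1 / n\<close>, and the box has of order
  \<open>n ^ d\<close> edges, each contributing at most \<open>(1 / n) powr r\<close>.\<close>

lemma capacity_le_powr:
  assumes "r > 0" "n \<ge> 1"
  shows "capacity TYPE('d::finite) r n \<le> 4 * real CARD('d) ^ 2 * 3 ^ (CARD('d) - 1) * real n powr (real CARD('d) - r)"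
proof -
  let ?d = "CARD('d)"
  have "capacity TYPE('d) r n \<le> (\<Sum>m\<le>n. 2 * real ?d ^ 2 * (2 * real m + 1) ^ (?d - 1) * (1 / real n) powr r)"
    using assms by (intro capacity_radial_le[where \<phi> = "\<lambda>m. real m / real n"])
      (auto simp: field_simps)
  also have "\<dots> \<le> (\<Sum>m\<le>n. 2 * real ?d ^ 2 * (3 * real n) ^ (?d - 1) * (1 / real n) powr r)"
    using assms by (intro sum_mono mult_right_mono mult_left_mono power_mono) auto
  also have "\<dots> = (real n + 1) * (2 * real ?d ^ 2 * (3 * real n) ^ (?d - 1) * (1 / real n) powr r)"
    by (simp add: add.commute)
  also have "\<dots> \<le> (2 * real n) * (2 * real ?d ^ 2 * (3 * real n) ^ (?d - 1) * (1 / real n) powr r)"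
    using assms by (intro mult_right_mono) auto
  also have "\<dots> = 4 * real ?d ^ 2 * 3 ^ (?d - 1) * (real n * real n ^ (?d - 1)) * (1 / real n) powr r"
    by (simp add: power_mult_distrib mult_ac)
  also have "real n * real n ^ (?d - 1) = real n powr real ?d"
    using assms by (simp add: powr_realpow power_eq_if)
  also have "4 * real ?d ^ 2 * 3 ^ (?d - 1) * real n powr real ?d * (1 / real n) powr r
      = 4 * real ?d ^ 2 * 3 ^ (?d - 1) * real n powr (real ?d - r)"
    using assms by (simp add: powr_diff powr_divide)
  finally show ?thesis .
qed

text \<open>The logarithmic profile has increments of order \<open>1 / (m * L)\<close> at radius m.
  With of order \<open>m ^ (d - 1)\<close> points there, the radius contributes
  \<open>1 / (m * L ^ d)\<close> up to a constant, and summing over m turns this into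
  \<open>L powr (1 - d)\<close>.\<close>

lemma capacity_le_ln:
  assumes "n \<ge> 2"
  shows "ln (real n) ^ (CARD('d) - 1) * capacity TYPE('d::finite) (real CARD('d)) n
    \<le> 2 * real CARD('d) ^ 2 * 4 ^ CARD('d) * (1 + 1 / ln 3)"
proof -
  let ?d = "CARD('d)"
  \<comment> \<open>The shift by one makes the profile \<open>ln (m + 1) / L\<close> vanish at 0 and
    equal 1 at n.\<close>
  define L where "L = ln (real n + 1)"
  have L: "L \<ge> ln 3" "L > 0" using assms by (auto simp: L_def)
  \<comment> \<open>The factor 2 lets \<open>g (Suc m)\<close> dominate the increment that starts at
    m, as \<open>1 / (m + 1) \<le> 2 / (m + 2)\<close>.\<close>
  define g :: "nat \<Rightarrow> real" where "g m = 2 / ((real m + 1) * L)" for m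
  have ln_step: "\<bar>ln (real (Suc m) + 1) / L - ln (real m + 1) / L\<bar> \<le> 1 / ((real m + 1) * L)" for m
  proof -
    have "ln (real m + 2) - ln (real m + 1) \<le> 1 / (real m + 1)"
      using ln_diff_le[of "real m + 2" "real m + 1"] by simp
    moreover have "ln (real m + 2) - ln (real m + 1) \<ge> 0" by simp
    ultimately have "(ln (real m + 2) - ln (real m + 1)) / L \<le> 1 / (real m + 1) / L"
      "(ln (real m + 2) - ln (real m + 1)) / L \<ge> 0"
      using L by (intro divide_right_mono divide_nonneg_pos; simp)+
    then show ?thesis by (simp add: diff_divide_distrib add.commute)
  qed
  have "1 / ((real m + 1) * L) \<le> g m" "1 / ((real m + 1) * L) \<le> g (Suc m)" for m
  proof -
    show "1 / ((real m + 1) * L) \<le> g m"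
      using L unfolding g_def by (intro divide_right_mono) auto
    have "1 / (real m + 1) \<le> 2 / (real (Suc m) + 1)"
      by (simp add: field_simps)
    then have "1 / (real m + 1) / L \<le> 2 / (real (Suc m) + 1) / L"
      using L by (intro divide_right_mono) auto
    then show "1 / ((real m + 1) * L) \<le> g (Suc m)" by (simp add: g_def)
  qed
  then have "capacity TYPE('d) (real ?d) n
      \<le> (\<Sum>m\<le>n. 2 * real ?d ^ 2 * (2 * real m + 1) ^ (?d - 1) * g m powr real ?d)"
    using L ln_step by (intro capacity_radial_le[where \<phi> = "\<lambda>m. ln (real m + 1) / L"])
      (auto simp: L_def intro: order_trans)
  also have "\<dots> \<le> (\<Sum>m\<le>n. 2 * real ?d ^ 2 * 4 ^ ?d / L ^ ?d * (real (Suc m) powr - 1))"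
  proof (rule sum_mono)
    fix m
    have "(2 * real m + 1) ^ (?d - 1) * g m powr real ?d \<le> (2 * (real m + 1)) ^ (?d - 1) * g m ^ ?d"
      using L by (subst powr_realpow) (auto simp: g_def intro!: mult_right_mono power_mono)
    also have "\<dots> \<le> (2 * (real m + 1)) ^ ?d / (2 * (real m + 1)) * g m ^ ?d"
      by (simp add: power_eq_if)
    also have "\<dots> = (2 * (real m + 1) * g m) ^ ?d / (2 * (real m + 1))"
      by (simp add: power_mult_distrib)
    also have "2 * (real m + 1) * g m = 4 / L"
    proof -
      have "real m + 1 \<noteq> 0" by linarith
      then have "(real m + 1) * L \<noteq> 0" using L by simp
      then show ?thesis using L by (simp add: g_def frac_eq_eq algebra_simps)
    qed
    also have "(4 / L) ^ ?d / (2 * (real m + 1)) = 4 ^ ?d / L ^ ?d / (2 * (real m + 1))"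
      by (simp add: power_divide)
    also have "\<dots> \<le> 4 ^ ?d / L ^ ?d * (real (Suc m) powr - 1)"
    proof -
      have "1 / (2 * (real m + 1)) \<le> real (Suc m) powr - 1"
        by (simp add: powr_minus field_simps)
      then have "4 ^ ?d / L ^ ?d * (1 / (2 * (real m + 1))) \<le> 4 ^ ?d / L ^ ?d * (real (Suc m) powr - 1)"
        using L by (intro mult_left_mono) auto
      then show ?thesis by simp
    qed
    finally have "2 * real ?d ^ 2 * ((2 * real m + 1) ^ (?d - 1) * g m powr real ?d)
        \<le> 2 * real ?d ^ 2 * (4 ^ ?d / L ^ ?d * (real (Suc m) powr - 1))"
      by (rule mult_left_mono) simp
    then show "2 * real ?d ^ 2 * (2 * real m + 1) ^ (?d - 1) * g m powr real ?d
        \<le> 2 * real ?d ^ 2 * 4 ^ ?d / L ^ ?d * (real (Suc m) powr - 1)"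
      by (simp only: divide_inverse mult.assoc)
  qed
  also have "\<dots> = 2 * real ?d ^ 2 * 4 ^ ?d / L ^ ?d * power_sum 1 (Suc n)"
    by (simp only: power_sum_def sum_distrib_left lessThan_Suc_atMost)
  also have "\<dots> \<le> 2 * real ?d ^ 2 * 4 ^ ?d / L ^ ?d * (1 + L)"
    using power_sum_1_le[of "Suc n"] L by (intro mult_left_mono) (auto simp: L_def add.commute)
  finally have cap: "capacity TYPE('d) (real ?d) n \<le> 2 * real ?d ^ 2 * 4 ^ ?d / L ^ ?d * (1 + L)" .
  have "ln (real n) ^ (?d - 1) * capacity TYPE('d) (real ?d) n
      \<le> ln (real n) ^ (?d - 1) * (2 * real ?d ^ 2 * 4 ^ ?d / L ^ ?d * (1 + L))"
    using assms by (intro mult_left_mono[OF cap]) auto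
  \<comment> \<open>Passing from \<open>ln n\<close> to the larger L makes the powers of L cancel
    exactly.\<close>
  also have "\<dots> \<le> L ^ (?d - 1) * (2 * real ?d ^ 2 * 4 ^ ?d / L ^ ?d * (1 + L))"
    using assms L by (intro mult_right_mono power_mono) (auto simp: L_def)
  also have "\<dots> = 2 * real ?d ^ 2 * 4 ^ ?d * (1 + 1 / L)"
  proof -
    have "L ^ ?d = L * L ^ (?d - 1)"
      by (metis power_minus_mult zero_less_card_finite mult.commute)
    then have "L ^ (?d - 1) * (2 * real ?d ^ 2 * 4 ^ ?d / L ^ ?d * (1 + L)) = 2 * real ?d ^ 2 * 4 ^ ?d * ((1 + L) / L)"
      using L by simp
    also have "(1 + L) / L = 1 + 1 / L"
      using L by (simp add: add_divide_distrib)
    finally show ?thesis .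
  qed
  also have "\<dots> \<le> 2 * real ?d ^ 2 * 4 ^ ?d * (1 + 1 / ln 3)"
    using L by (intro mult_left_mono add_left_mono divide_left_mono) auto
  finally show ?thesis .
qed

section \<open>Lower bound: the flow of a Polya urn\<close>

text \<open>The strict upper bound is chosen so that a positive step from this set ends in
  \<open>box_D n\<close>, and in \<open>bdry_D n\<close> if it leaves the set.\<close>

definition orthant_box :: "nat \<Rightarrow> (int ^ 'd::finite) set" where
  "orthant_box n = {x. \<forall>i. 0 \<le> x $ i \<and> x $ i < int n}"

lemma orthant_box_D:
  assumes "x \<in> orthant_box n"
  shows "x \<in> box_D n" "x + axis i 1 \<in> box_D n"
proof -
  have "0 \<le> x $ j" "x $ j < int n" for j using assms by (auto simp: orthant_box_def)
  then have "\<bar>x $ j\<bar> \<le> int n" "\<bar>(x + axis i 1) $ j\<bar> \<le> int n" for j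
    by (simp_all add: axis_def less_imp_le zless_imp_add1_zle)
  then show "x \<in> box_D n" "x + axis i 1 \<in> box_D n"
    unfolding box_D_def sup_norm_le_iff mem_Collect_eq by blast+
qed

lemma finite_orthant_box: "finite (orthant_box n :: (int ^ 'd::finite) set)"
  using orthant_box_D(1) finite_box_D[of n, where 'd = 'd] by (meson finite_subset subsetI)

text \<open>On the positive orthant this is the l1 distance to the origin, that is, the number of
  draws from the urn; \<open>nat\<close> is harmless there.\<close>

definition level :: "int ^ 'd::finite \<Rightarrow> nat" where
  "level x = nat (\<Sum>i\<in>UNIV. x $ i)"

lemma of_nat_level:
  assumes "x \<in> orthant_box n"
  shows "int (level x) = (\<Sum>i\<in>UNIV. x $ i)"
  using assms by (simp add: level_def orthant_box_def sum_nonneg)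

lemma level_less:
  fixes x :: "int ^ 'd::finite"
  assumes "x \<in> orthant_box n"
  shows "level x < CARD('d) * n"
proof -
  have "(\<Sum>i\<in>UNIV. x $ i) < (\<Sum>i\<in>(UNIV :: 'd set). int n)"
    using assms by (intro sum_strict_mono) (auto simp: orthant_box_def)
  then show ?thesis by (simp flip: of_nat_level[OF assms] of_nat_mult)
qed

text \<open>On a level, the sum of the coordinates is fixed, so one coordinate is determined by the
  others, and all of them lie between 0 and k.\<close>

lemma card_level_le:
  "card {x :: int ^ 'd::finite. x \<in> orthant_box n \<and> level x = k} \<le> (k + 1) ^ (CARD('d) - 1)"
proof -
  let ?A = "{x :: int ^ 'd. x \<in> orthant_box n \<and> level x = k}"
  obtain i :: 'd where True by simp
  have "card ?A \<le> card {0..int k} ^ (CARD('d) - 1)"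
  proof (rule card_determined_coordinate[where i = i])
    show "x $ j \<in> {0..int k}" if "x \<in> ?A" for x j
    proof -
      have "x $ j \<le> (\<Sum>i\<in>UNIV. x $ i)"
        using that by (intro member_le_sum) (auto simp: orthant_box_def)
      then show ?thesis using that of_nat_level[of x n] by (auto simp: orthant_box_def)
    qed
    show "x $ i = y $ i" if "x \<in> ?A" "y \<in> ?A" and "\<And>j. j \<noteq> i \<Longrightarrow> x $ j = y $ j" for x y
    proof -
      have "(\<Sum>j\<in>UNIV. x $ j) = (\<Sum>j\<in>UNIV. y $ j)"
        using that of_nat_level[of x n] of_nat_level[of y n] by simp
      moreover have "(\<Sum>j\<in>UNIV - {i}. x $ j) = (\<Sum>j\<in>UNIV - {i}. y $ j)"
        using that by (intro sum.cong) auto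
      ultimately show ?thesis by (simp add: sum.remove[of UNIV i])
    qed
  qed simp
  then show ?thesis by (simp add: nat_add_distrib)
qed

text \<open>This is the reciprocal of the binomial coefficient \<open>(k + D) choose D\<close>. For
  \<open>D = d - 1\<close> that coefficient counts the points of level k in the positive orthant of
  dimension d.\<close>

definition urn_prob :: "nat \<Rightarrow> nat \<Rightarrow> real" where
  "urn_prob D k = (\<Prod>j\<in>{1..D}. real j / (real k + real j))"

lemma urn_prob_pos: "urn_prob D k > 0"
  unfolding urn_prob_def by (intro prod_pos) auto

lemma urn_prob_0 [simp]: "urn_prob D 0 = 1"
  by (simp add: urn_prob_def)

lemma urn_prob_le_1: "urn_prob D k \<le> 1"
  unfolding urn_prob_def by (intro prod_le_1) auto

text \<open>The ratio of consecutive reciprocal binomial coefficients; it is what makes inflow and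
  outflow of the urn flow balance.\<close>

lemma urn_prob_Suc: "urn_prob D (Suc k) * (real k + real D + 1) = urn_prob D k * (real k + 1)"
proof (induction D)
  case 0
  then show ?case by (simp add: urn_prob_def)
next
  case (Suc D)
  have step: "urn_prob (Suc D) j = urn_prob D j * ((real D + 1) / (real j + real D + 1))" for j
    by (simp add: urn_prob_def add_ac)
  have "urn_prob (Suc D) (Suc k) * (real k + real (Suc D) + 1) = urn_prob D (Suc k) * (real D + 1)"
    by (simp add: step field_simps)
  also have "\<dots> = urn_prob D (Suc k) * (real k + real D + 1) * ((real D + 1) / (real k + real D + 1))"
    by (simp add: field_simps)
  also have "\<dots> = urn_prob (Suc D) k * (real k + 1)"
    by (simp add: Suc.IH step)
  finally show ?case .
qed

text \<open>Each of the D factors \<open>j / (k + j)\<close> is at most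
  \<open>(D + 1) / (k + 1)\<close>, because \<open>j \<le> D\<close>.\<close>

lemma urn_prob_le: "urn_prob D k \<le> (real (Suc D) / real (Suc k)) ^ D"
proof -
  have "urn_prob D k \<le> (\<Prod>j\<in>{1..D}. real (Suc D) / real (Suc k))"
    unfolding urn_prob_def
  proof (intro prod_mono conjI)
    fix j assume j: "j \<in> {1..D}"
    have "j * Suc k \<le> Suc D * (k + j)"
    proof -
      have "j * Suc k = j * k + j" by simp
      also have "\<dots> \<le> Suc D * k + Suc D * j"
        using j by (intro add_mono mult_right_mono) auto
      finally show ?thesis by (simp add: algebra_simps)
    qed
    then have "real j * real (Suc k) \<le> real (Suc D) * (real k + real j)"
      by (metis of_nat_add of_nat_le_iff of_nat_mult)
    then show "real j / (real k + real j) \<le> real (Suc D) / real (Suc k)"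
      using j by (simp add: divide_le_eq pos_le_divide_eq mult.commute del: of_nat_Suc)
  qed auto
  then show ?thesis by simp
qed

text \<open>The urn chain moves from x to \<open>x + axis i 1\<close> with probability
  \<open>(x $ i + 1) / (level x + d)\<close>; it is uniformly distributed on each level of the orthant, so
  that \<open>urn_prob (d - 1) (level x)\<close> is the probability of visiting x.\<close>

definition urn_flow :: "int ^ 'd::finite \<Rightarrow> 'd \<Rightarrow> real" where
  "urn_flow x i = urn_prob (CARD('d) - 1) (level x) *
     (real_of_int (x $ i + 1) / (real (level x) + real CARD('d)))"

text \<open>The transition probability lies between 0 and 1, since
  \<open>x $ i \<le> level x\<close> and \<open>1 \<le> d\<close>.\<close>

lemma urn_flow_bounds:
  fixes x :: "int ^ 'd::finite"
  assumes "x \<in> orthant_box n"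
  shows "0 \<le> urn_flow x i" "urn_flow x i \<le> urn_prob (CARD('d) - 1) (level x)"
proof -
  have "x $ i \<le> (\<Sum>i\<in>UNIV. x $ i)"
    using assms by (intro member_le_sum) (auto simp: orthant_box_def)
  then have "x $ i \<le> int (level x)" by (simp add: of_nat_level[OF assms])
  then have le: "real_of_int (x $ i) \<le> real (level x)"
    by (metis of_int_le_iff of_int_of_nat_eq)
  moreover have "real CARD('d) \<ge> 1" by (simp add: Suc_le_eq)
  ultimately have "real_of_int (x $ i + 1) \<le> real (level x) + real CARD('d)"
    "real (level x) + real CARD('d) > 0"
    by linarith+
  then have "real_of_int (x $ i + 1) / (real (level x) + real CARD('d)) \<le> 1"
    by (simp only: divide_le_eq_1_pos)
  then show "urn_flow x i \<le> urn_prob (CARD('d) - 1) (level x)"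
    unfolding urn_flow_def using urn_prob_pos by (intro mult_left_le) (auto intro: less_imp_le)
  have "0 \<le> x $ i" using assms by (auto simp: orthant_box_def)
  then show "0 \<le> urn_flow x i"
    unfolding urn_flow_def using less_imp_le[OF urn_prob_pos] by simp
qed

text \<open>The transition probabilities out of x add up to 1.\<close>

lemma sum_urn_flow_out:
  fixes x :: "int ^ 'd::finite"
  assumes "x \<in> orthant_box n"
  shows "(\<Sum>i\<in>UNIV. urn_flow x i) = urn_prob (CARD('d) - 1) (level x)"
proof -
  have "(\<Sum>i\<in>UNIV. real_of_int (x $ i + 1)) = real_of_int (\<Sum>i\<in>UNIV. x $ i) + real CARD('d)"
    by (simp add: sum.distrib)
  also have "real_of_int (\<Sum>i\<in>UNIV. x $ i) = real (level x)"
    by (simp flip: of_nat_level[OF assms])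
  moreover have "real (level x) + real CARD('d) > 0" by (simp add: add_nonneg_pos)
  ultimately show ?thesis
    by (simp add: urn_flow_def flip: sum_distrib_left sum_divide_distrib)
qed

text \<open>All predecessors of y share the level \<open>k = level y - 1\<close>, and the one in
  direction i has numerator \<open>y $ i\<close>, which is 0 if it lies outside the orthant. The
  numerators add up to \<open>k + 1\<close>, and \<open>urn_prob_Suc\<close> finishes.\<close>

lemma sum_urn_flow_in:
  fixes y :: "int ^ 'd::finite"
  assumes "y \<in> orthant_box n" "y \<noteq> 0"
  shows "(\<Sum>i\<in>UNIV. urn_flow (y - axis i 1) i) = urn_prob (CARD('d) - 1) (level y)"
proof -
  let ?D = "CARD('d) - 1"
  have nn: "y $ i \<ge> 0" for i using assms by (auto simp: orthant_box_def)
  have "(\<Sum>i\<in>UNIV. y $ i) \<noteq> 0"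
    using assms nn by (auto simp: sum_nonneg_eq_0_iff vec_eq_iff)
  then obtain k where k: "level y = Suc k"
    using of_nat_level[OF assms(1)] by (metis not0_implies_Suc of_nat_0)
  have lev: "level (y - axis i 1) = k" for i
    using k by (simp add: level_def sum_subtractf axis_def)
  have d: "real k + real CARD('d) = real k + real ?D + 1"
    by (simp add: of_nat_diff Suc_le_eq)
  have "(\<Sum>i\<in>UNIV. urn_flow (y - axis i 1) i)
      = urn_prob ?D k * (real_of_int (\<Sum>i\<in>UNIV. y $ i) / (real k + real CARD('d)))"
    by (simp add: urn_flow_def lev flip: sum_distrib_left sum_divide_distrib)
  also have "real_of_int (\<Sum>i\<in>UNIV. y $ i) = real k + 1"
    using k by (simp flip: of_nat_level[OF assms(1)])
  also have "urn_prob ?D k * ((real k + 1) / (real k + real CARD('d))) = urn_prob ?D (Suc k)"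
  proof -
    have "real k + real ?D + 1 \<noteq> 0" by linarith
    then show ?thesis
      unfolding d using urn_prob_Suc[of ?D k]
      by (metis nonzero_mult_div_cancel_right times_divide_eq_right)
  qed
  finally show ?thesis by (simp add: k)
qed

text \<open>Summation by parts against \<open>h = 1 - f\<close>: the flow is divergence free away from the origin,
  and the boundary terms have the right sign because \<open>h \<le> 0\<close> there.\<close>

lemma urn_flow_telescope:
  fixes f :: "int ^ 'd::finite \<Rightarrow> real"
  assumes "n \<ge> 1" and f: "f \<in> admissible n"
  shows "1 \<le> (\<Sum>(x, i)\<in>orthant_box n \<times> UNIV. urn_flow x i * (f (x + axis i 1) - f x))"
proof -
  let ?I = "orthant_box n :: (int ^ 'd) set" and ?p = "urn_prob (CARD('d) - 1)"
  define h where "h x = 1 - f x" for x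
  have h0: "h 0 = 1" and hb: "\<And>x. x \<in> bdry_D n \<Longrightarrow> h x \<le> 0"
    using f by (auto simp: admissible_def h_def)
  have zero: "0 \<in> ?I" using assms by (simp add: orthant_box_def)
  have inflow: "(\<Sum>x\<in>?I. urn_flow x i * h (x + axis i 1)) \<le> (\<Sum>y\<in>?I - {0}. urn_flow (y - axis i 1) i * h y)" for i
  proof -
    let ?J = "(\<lambda>x. x + axis i 1) ` ?I"
    have "(\<Sum>x\<in>?I. urn_flow x i * h (x + axis i 1)) = (\<Sum>y\<in>?J. urn_flow (y - axis i 1) i * h y)"
      by (subst sum.reindex) (auto simp: inj_on_def)
    \<comment> \<open>A shifted point outside \<open>?I\<close> lies in \<open>bdry_D n\<close>;
      there the flow is nonnegative and \<open>h \<le> 0\<close>, so dropping it can only increase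
      the sum.\<close>
    also have "\<dots> \<le> (\<Sum>y\<in>?J \<inter> ?I. urn_flow (y - axis i 1) i * h y)"
    proof -
      have "(\<Sum>y\<in>?J - ?J \<inter> ?I. urn_flow (y - axis i 1) i * h y) \<le> 0"
      proof (rule sum_nonpos)
        fix y assume "y \<in> ?J - ?J \<inter> ?I"
        then obtain x where x: "x \<in> ?I" "y = x + axis i 1" "y \<notin> ?I" by auto
        have "y \<in> box_D n" using x orthant_box_D by blast
        moreover obtain j where "\<not> (0 \<le> y $ j \<and> y $ j < int n)"
          using x(3) by (auto simp: orthant_box_def)
        then have "y $ j \<ge> int n"
          using x(1,2) by (auto simp: orthant_box_def axis_def split: if_splits)
        then have "sup_norm y \<ge> int n"
          using sup_norm_le_iff[of y "sup_norm y"] by (smt (verit))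
        ultimately have "h y \<le> 0" by (intro hb) (auto simp: box_D_def bdry_D_def)
        then show "urn_flow (y - axis i 1) i * h y \<le> 0"
          using urn_flow_bounds(1)[OF x(1), of i] x(2) by (simp add: mult_nonneg_nonpos)
      qed
      then show ?thesis
        by (subst sum.subset_diff[of "?J \<inter> ?I" ?J]) (auto simp: finite_orthant_box)
    qed
    \<comment> \<open>The points of \<open>?I - {0}\<close> that are not shifts have
      \<open>y $ i = 0\<close>, and no flow enters them in direction i.\<close>
    also have "\<dots> = (\<Sum>y\<in>?I - {0}. urn_flow (y - axis i 1) i * h y)"
    proof (rule sum.mono_neutral_left)
      have "0 \<notin> ?J"
      proof
        assume "0 \<in> ?J"
        then obtain x where "x \<in> ?I" "x + axis i 1 = 0" by auto
        then have "x $ i + 1 = 0" "x $ i \<ge> 0"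
          by (auto simp: orthant_box_def dest: arg_cong[where f = "\<lambda>v. v $ i"])
        then show False by simp
      qed
      then show "?J \<inter> ?I \<subseteq> ?I - {0}" by auto
      show "\<forall>y\<in>?I - {0} - ?J \<inter> ?I. urn_flow (y - axis i 1) i * h y = 0"
      proof
        fix y assume y: "y \<in> ?I - {0} - ?J \<inter> ?I"
        then have "y - axis i 1 \<notin> ?I" by (metis Diff_iff IntI diff_add_cancel imageI)
        then obtain j where "\<not> (0 \<le> (y - axis i 1) $ j \<and> (y - axis i 1) $ j < int n)"
          by (auto simp: orthant_box_def)
        moreover have "0 \<le> y $ j" "y $ j < int n" using y by (auto simp: orthant_box_def)
        ultimately have "y $ i = 0" by (auto simp: axis_def split: if_splits)
        then show "urn_flow (y - axis i 1) i * h y = 0" by (simp add: urn_flow_def)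
      qed
    qed (auto simp: finite_orthant_box)
    finally show ?thesis .
  qed
  have "(\<Sum>(x, i)\<in>?I \<times> UNIV. urn_flow x i * (f (x + axis i 1) - f x))
      = (\<Sum>x\<in>?I. \<Sum>i\<in>UNIV. urn_flow x i * h x - urn_flow x i * h (x + axis i 1))"
    by (simp add: sum.cartesian_product[symmetric] h_def algebra_simps)
  also have "\<dots> = (\<Sum>x\<in>?I. (\<Sum>i\<in>UNIV. urn_flow x i) * h x)
      - (\<Sum>x\<in>?I. \<Sum>i\<in>UNIV. urn_flow x i * h (x + axis i 1))"
    by (simp add: sum_subtractf sum_distrib_right)
  also have "(\<Sum>x\<in>?I. (\<Sum>i\<in>UNIV. urn_flow x i) * h x) = (\<Sum>x\<in>?I. ?p (level x) * h x)"
    by (intro sum.cong refl) (simp add: sum_urn_flow_out)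
  \<comment> \<open>The origin is visited with probability 1 and \<open>h 0 = 1\<close>: this term
    is the unit strength of the flow.\<close>
  also have "\<dots> = 1 + (\<Sum>x\<in>?I - {0}. ?p (level x) * h x)"
    using zero by (subst sum.remove[of _ 0]) (auto simp: finite_orthant_box h0 level_def)
  also have "(\<Sum>x\<in>?I. \<Sum>i\<in>UNIV. urn_flow x i * h (x + axis i 1))
      = (\<Sum>i\<in>UNIV. \<Sum>x\<in>?I. urn_flow x i * h (x + axis i 1))"
    by (rule sum.swap)
  finally have eq: "(\<Sum>(x, i)\<in>?I \<times> UNIV. urn_flow x i * (f (x + axis i 1) - f x))
      = 1 + (\<Sum>x\<in>?I - {0}. ?p (level x) * h x) - (\<Sum>i\<in>UNIV. \<Sum>x\<in>?I. urn_flow x i * h (x + axis i 1))" .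
  have "(\<Sum>i\<in>UNIV. \<Sum>x\<in>?I. urn_flow x i * h (x + axis i 1))
      \<le> (\<Sum>i\<in>UNIV. \<Sum>y\<in>?I - {0}. urn_flow (y - axis i 1) i * h y)"
    by (intro sum_mono inflow)
  also have "\<dots> = (\<Sum>y\<in>?I - {0}. (\<Sum>i\<in>UNIV. urn_flow (y - axis i 1) i) * h y)"
    by (subst sum.swap) (simp add: sum_distrib_right)
  also have "\<dots> = (\<Sum>y\<in>?I - {0}. ?p (level y) * h y)"
    by (intro sum.cong refl) (use sum_urn_flow_in in auto)
  finally show ?thesis unfolding eq by linarith
qed

text \<open>The flow is replaced by its upper bound, the visiting probability, which depends on the
  level alone and can therefore be summed level by level.\<close>

lemma urn_prob_gradient_ge:
  fixes f :: "int ^ 'd::finite \<Rightarrow> real"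
  assumes "n \<ge> 1" "f \<in> admissible n"
  shows "1 \<le> (\<Sum>(x, i)\<in>orthant_box n \<times> UNIV. urn_prob (CARD('d) - 1) (level x) * \<bar>f (x + axis i 1) - f x\<bar>)"
proof -
  note urn_flow_telescope[OF assms]
  also have "(\<Sum>(x, i)\<in>orthant_box n \<times> UNIV. urn_flow x i * (f (x + axis i 1) - f x))
      \<le> (\<Sum>(x, i)\<in>orthant_box n \<times> UNIV. urn_prob (CARD('d) - 1) (level x) * \<bar>f (x + axis i 1) - f x\<bar>)"
  proof (rule sum_mono, clarify)
    fix x :: "int ^ 'd" and i assume x: "x \<in> orthant_box n"
    have "urn_flow x i * (f (x + axis i 1) - f x) \<le> urn_flow x i * \<bar>f (x + axis i 1) - f x\<bar>"
      using urn_flow_bounds[OF x] by (intro mult_left_mono) auto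
    also have "\<dots> \<le> urn_prob (CARD('d) - 1) (level x) * \<bar>f (x + axis i 1) - f x\<bar>"
      using urn_flow_bounds[OF x] by (intro mult_right_mono) auto
    finally show "urn_flow x i * (f (x + axis i 1) - f x)
      \<le> urn_prob (CARD('d) - 1) (level x) * \<bar>f (x + axis i 1) - f x\<bar>" .
  qed
  finally show ?thesis .
qed

section \<open>Energy bounds from the flow\<close>

lemma orthant_energy_le:
  fixes f :: "int ^ 'd::finite \<Rightarrow> real"
  shows "(\<Sum>(x, i)\<in>orthant_box n \<times> UNIV. \<bar>f (x + axis i 1) - f x\<bar> powr r) \<le> energy r n f"
  unfolding energy_eq
proof (rule sum_mono2)
  show "finite {(x :: int ^ 'd, i). x \<in> box_D n \<and> x + axis i 1 \<in> box_D n}"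
    by (rule finite_subset[of _ "box_D n \<times> UNIV"]) (auto simp: finite_box_D)
qed (use orthant_box_D in auto)

text \<open>Either a single gradient is at least 1 and its power suffices, or all gradients are
  below 1, where \<open>t \<le> t powr r\<close>, and their sum is at least 1 because the flow is
  bounded by 1.\<close>

lemma energy_ge_1:
  fixes f :: "int ^ 'd::finite \<Rightarrow> real"
  assumes "0 < r" "r \<le> 1" "n \<ge> 1" "f \<in> admissible n"
  shows "1 \<le> energy r n f"
proof -
  let ?K = "(orthant_box n :: (int ^ 'd) set) \<times> (UNIV :: 'd set)"
  define a where "a = (\<lambda>(x, i :: 'd). \<bar>f (x + axis i 1) - f x\<bar>)"
  have fin: "finite ?K" by (simp add: finite_orthant_box)
  have a: "a z \<ge> 0" for z by (simp add: a_def split: prod.splits)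
  have "1 \<le> (\<Sum>z\<in>?K. a z powr r)"
  proof (cases "\<exists>z\<in>?K. a z \<ge> 1")
    case True
    then obtain z where z: "z \<in> ?K" "a z \<ge> 1" by blast
    have "1 \<le> a z powr r" using z assms by (intro ge_one_powr_ge_zero) auto
    also have "\<dots> \<le> (\<Sum>z\<in>?K. a z powr r)" using z fin by (intro member_le_sum) auto
    finally show ?thesis .
  next
    case False
    have "1 \<le> (\<Sum>(x, i)\<in>?K. urn_prob (CARD('d) - 1) (level x) * \<bar>f (x + axis i 1) - f x\<bar>)"
      using urn_prob_gradient_ge assms by blast
    also have "\<dots> \<le> (\<Sum>z\<in>?K. a z)"
      unfolding a_def split_def using urn_prob_le_1 by (intro sum_mono mult_left_le_one_le less_imp_le[OF urn_prob_pos]) auto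
    also have "\<dots> \<le> (\<Sum>z\<in>?K. a z powr r)"
    proof (rule sum_mono)
      fix z assume "z \<in> ?K"
      then have "a z < 1" using False not_le by blast
      then show "a z \<le> a z powr r"
        using powr_mono'[of r 1 "a z"] assms a[of z] by simp
    qed
    finally show ?thesis .
  qed
  then show ?thesis
    using orthant_energy_le[where f = f and n = n and r = r] by (simp add: a_def split_def)
qed

text \<open>Level k has at most \<open>(k + 1) ^ (d - 1)\<close> points, each weighing at most
  \<open>(d / (k + 1)) powr ((d - 1) * q)\<close>; the powers of \<open>k + 1\<close> combine to
  exponent \<open>- (d - 1) * (q - 1)\<close>. The outer factor d counts directions.\<close>

lemma sum_urn_prob_powr_le:
  assumes "q > 1"
  shows "(\<Sum>(x, i)\<in>(orthant_box n :: (int ^ 'd::finite) set) \<times> (UNIV :: 'd set). urn_prob (CARD('d) - 1) (level x) powr q)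
    \<le> real CARD('d) * real CARD('d) powr (real (CARD('d) - 1) * q)
        * power_sum (real (CARD('d) - 1) * (q - 1)) (CARD('d) * n)"
proof -
  let ?I = "orthant_box n :: (int ^ 'd) set" and ?d = "CARD('d)" and ?D = "CARD('d) - 1"
  have Suc: "Suc ?D = ?d" by simp
  have "(\<Sum>(x, i)\<in>?I \<times> (UNIV :: 'd set). urn_prob ?D (level x) powr q)
      = real ?d * (\<Sum>x\<in>?I. urn_prob ?D (level x) powr q)"
    by (simp add: sum.cartesian_product[symmetric] sum_distrib_left)
  also have "(\<Sum>x\<in>?I. urn_prob ?D (level x) powr q)
      = (\<Sum>k<?d * n. \<Sum>x | x \<in> ?I \<and> level x = k. urn_prob ?D (level x) powr q)"
    using level_less by (subst sum.group) (auto simp: finite_orthant_box)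
  also have "\<dots> \<le> (\<Sum>k<?d * n. real ?d powr (real ?D * q) * real (Suc k) powr - (real ?D * (q - 1)))"
  proof (rule sum_mono)
    fix k
    have "(\<Sum>x | x \<in> ?I \<and> level x = k. urn_prob ?D (level x) powr q)
        = real (card {x. x \<in> ?I \<and> level x = k}) * urn_prob ?D k powr q"
      by simp
    also have "\<dots> \<le> real ((k + 1) ^ ?D) * ((real ?d / real (Suc k)) ^ ?D) powr q"
      using assms urn_prob_le[of ?D k] less_imp_le[OF urn_prob_pos[of ?D k]]
      by (intro mult_mono powr_mono2 of_nat_mono card_level_le) (simp_all only: Suc, simp_all)
    also have "((real ?d / real (Suc k)) ^ ?D) powr q = (real ?d / real (Suc k)) powr (real ?D * q)"
      by (subst powr_realpow[symmetric]) (auto simp: powr_powr)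
    also have "\<dots> = real ?d powr (real ?D * q) * real (Suc k) powr - (real ?D * q)"
      by (simp only: powr_divide powr_minus_divide of_nat_0_le_iff) simp
    also have "real ((k + 1) ^ ?D) = real (Suc k) powr real ?D"
      by (subst powr_realpow) auto
    also have "real (Suc k) powr real ?D * (real ?d powr (real ?D * q) * real (Suc k) powr - (real ?D * q))
        = real ?d powr (real ?D * q) * real (Suc k) powr - (real ?D * (q - 1))"
    proof -
      have "- (real ?D * (q - 1)) = real ?D + - (real ?D * q)" by (simp add: algebra_simps)
      then show ?thesis by (simp only: powr_add mult_ac)
    qed
    finally show "(\<Sum>x | x \<in> ?I \<and> level x = k. urn_prob ?D (level x) powr q)
        \<le> real ?d powr (real ?D * q) * real (Suc k) powr - (real ?D * (q - 1))" .
  qed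
  also have "\<dots> = real ?d powr (real ?D * q) * power_sum (real ?D * (q - 1)) (?d * n)"
    by (simp add: power_sum_def sum_distrib_left)
  finally show ?thesis by (simp add: mult.assoc mult_left_mono)
qed

text \<open>Hoelder's inequality gives \<open>1 \<le> S powr (1 / q) * E powr (1 / r)\<close>, with
  S the q-energy of the flow bound and E the energy on the orthant. Raised to the power r this reads
  \<open>1 \<le> S powr (r - 1) * E\<close>, and S is at most a constant times the power
  sum.\<close>

lemma energy_ge_power_sum:
  assumes "r > 1"
  obtains c where "c > 0"
    "\<And>n f. n \<ge> 1 \<Longrightarrow> f \<in> (admissible n :: (int ^ 'd::finite \<Rightarrow> real) set) \<Longrightarrow>
       c * power_sum (real (CARD('d) - 1) / (r - 1)) (CARD('d) * n) powr (1 - r) \<le> energy r n f"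
proof
  let ?d = "CARD('d)" and ?D = "CARD('d) - 1"
  \<comment> \<open>The conjugate exponent of r; as \<open>q - 1 = 1 / (r - 1)\<close>, the power
    sum gets exponent \<open>(d - 1) / (r - 1)\<close>.\<close>
  define q where "q = r / (r - 1)"
  have q: "q > 1" "1 / q + 1 / r = 1" "q - 1 = 1 / (r - 1)" "1 / q * r = r - 1"
    using assms by (auto simp: q_def field_simps)
  define M where "M = real ?d * real ?d powr (real ?D * q)"
  have M: "M > 0" by (simp add: M_def)
  show "M powr (1 - r) > 0" using M by simp
  fix n :: nat and f :: "int ^ 'd \<Rightarrow> real"
  assume n: "n \<ge> 1" and f: "f \<in> admissible n"
  let ?K = "(orthant_box n :: (int ^ 'd) set) \<times> (UNIV :: 'd set)"
  let ?P = "power_sum (real ?D / (r - 1)) (?d * n)"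
  have P: "?P > 0" using n by (intro power_sum_pos) auto
  define a where "a = (\<lambda>(x :: int ^ 'd, i :: 'd). urn_prob ?D (level x))"
  define b where "b = (\<lambda>(x, i). \<bar>f (x + axis i 1) - f x\<bar>)"
  define S where "S = (\<Sum>z\<in>?K. a z powr q)"
  define E where "E = (\<Sum>z\<in>?K. b z powr r)"
  have nn: "a z \<ge> 0" "b z \<ge> 0" for z
    by (auto simp: a_def b_def less_imp_le[OF urn_prob_pos] split: prod.splits)
  have "1 \<le> (\<Sum>z\<in>?K. a z * b z)"
    using urn_prob_gradient_ge[OF n f] by (simp add: a_def b_def split_def)
  also have "\<dots> \<le> S powr (1 / q) * E powr (1 / r)"
    unfolding S_def E_def using q assms nn by (intro Holder_sum) auto
  finally have "1 \<le> (S powr (1 / q) * E powr (1 / r)) powr r"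
    using assms by (intro ge_one_powr_ge_zero) auto
  also have "\<dots> = S powr (r - 1) * E"
    using assms q(4) by (simp add: powr_mult powr_powr E_def sum_nonneg)
  also have "\<dots> \<le> (M * ?P) powr (r - 1) * E"
  proof -
    have "S \<le> M * ?P"
      using sum_urn_prob_powr_le[OF q(1), of n, where 'd = 'd] q(3)
      by (simp add: S_def a_def M_def split_def)
    moreover have "S \<ge> 0" "E \<ge> 0" by (auto simp: S_def E_def intro: sum_nonneg)
    ultimately show ?thesis using assms by (intro mult_right_mono powr_mono2) auto
  qed
  finally have "(M * ?P) powr (1 - r) * 1 \<le> (M * ?P) powr (1 - r) * ((M * ?P) powr (r - 1) * E)"
    by (intro mult_left_mono) auto
  also have "\<dots> = (M * ?P) powr (1 - r + (r - 1)) * E"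
    by (simp only: powr_add mult.assoc)
  also have "\<dots> = E" using M P by simp
  also have "\<dots> \<le> energy r n f"
    using orthant_energy_le[where f = f and n = n and r = r] by (simp add: E_def b_def split_def)
  finally show "M powr (1 - r) * ?P powr (1 - r) \<le> energy r n f"
    using M P by (simp add: powr_mult)
qed

lemma capacity_ge:
  assumes "n \<ge> 1" "\<And>f. f \<in> (admissible n :: (int ^ 'd::finite \<Rightarrow> real) set) \<Longrightarrow> c \<le> energy r n f"
  shows "c \<le> capacity TYPE('d) r n"
  unfolding capacity_def using admissible_nonempty assms by (intro cINF_greatest) auto

section \<open>The growth of the capacity\<close>

lemma kappa_upper:
  assumes "r > 0"
  shows "\<exists>C. \<forall>n\<ge>2. kappa TYPE('d::finite) r n \<le> C"
proof -
  consider "r < real CARD('d)" | "r = real CARD('d)" | "r > real CARD('d)" by linarith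
  then show ?thesis
  proof cases
    case 1
    have "kappa TYPE('d) r n \<le> 2 * real CARD('d) ^ 2 * (1 + 3 ^ (CARD('d) - 1))" if "n \<ge> 2" for n
      using capacity_le_bounded[OF assms, of n, where 'd = 'd] that 1 by (simp add: kappa_def)
    then show ?thesis by blast
  next
    case 2
    have "kappa TYPE('d) r n \<le> 2 * real CARD('d) ^ 2 * 4 ^ CARD('d) * (1 + 1 / ln 3)" if "n \<ge> 2" for n
      using capacity_le_ln[OF that, where 'd = 'd] 2 by (simp add: kappa_def)
    then show ?thesis by blast
  next
    case 3
    have "kappa TYPE('d) r n \<le> 4 * real CARD('d) ^ 2 * 3 ^ (CARD('d) - 1)" if "n \<ge> 2" for n
    proof -
      have "real n powr (r - real CARD('d)) * capacity TYPE('d) r n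
          \<le> real n powr (r - real CARD('d)) * (4 * real CARD('d) ^ 2 * 3 ^ (CARD('d) - 1) * real n powr (real CARD('d) - r))"
        using that by (intro mult_left_mono capacity_le_powr[OF assms]) auto
      also have "\<dots> = 4 * real CARD('d) ^ 2 * 3 ^ (CARD('d) - 1) * real n powr ((r - real CARD('d)) + (real CARD('d) - r))"
        by (simp only: powr_add mult_ac)
      also have "\<dots> = 4 * real CARD('d) ^ 2 * 3 ^ (CARD('d) - 1)" using that by simp
      finally show ?thesis using 3 by (simp add: kappa_def)
    qed
    then show ?thesis by blast
  qed
qed

text \<open>For \<open>r > 1\<close>, the exponent \<open>s = (d - 1) / (r - 1)\<close> is above,
  equal to or below 1 exactly when r is below, equal to or above d, so the three estimates of
  \<open>power_sum\<close> match the three cases of \<open>kappa\<close>.\<close>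

lemma kappa_lower:
  assumes "r > 0"
  shows "\<exists>c>0. \<forall>n\<ge>2. c \<le> kappa TYPE('d::finite) r n"
proof (cases "r \<le> 1")
  case True
  have cap: "1 \<le> capacity TYPE('d) r n" if "n \<ge> 2" for n
    using that True assms by (intro capacity_ge energy_ge_1) auto
  have "CARD('d) \<ge> 1" by (simp add: Suc_le_eq)
  \<comment> \<open>Since \<open>r \<le> 1 \<le> d\<close>, equality forces \<open>d = 1\<close>,
    where the logarithmic factor has exponent 0.\<close>
  then have "r < real CARD('d) \<or> r = real CARD('d) \<and> CARD('d) - 1 = 0"
    using True by linarith
  then have "\<forall>n\<ge>2. 1 \<le> kappa TYPE('d) r n"
    using cap by (auto simp: kappa_def)
  then show ?thesis by (intro exI[of _ 1]) auto
next
  case False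
  then have r: "r > 1" by simp
  let ?d = "CARD('d)" and ?D = "CARD('d) - 1"
  define s where "s = real ?D / (r - 1)"
  have D: "real ?D = real ?d - 1" by (simp add: of_nat_diff Suc_le_eq)
  obtain c where c: "c > 0" "\<And>n f. n \<ge> 1 \<Longrightarrow> f \<in> (admissible n :: (int ^ 'd \<Rightarrow> real) set) \<Longrightarrow>
       c * power_sum s (?d * n) powr (1 - r) \<le> energy r n f"
    using energy_ge_power_sum[OF r, where 'd = 'd] unfolding s_def by metis
  \<comment> \<open>The exponent \<open>1 - r\<close> is negative, so upper bounds on the power sum
    become lower bounds on the capacity.\<close>
  have cap: "c * B powr (1 - r) \<le> capacity TYPE('d) r n" if "n \<ge> 1" "power_sum s (?d * n) \<le> B" for n B
  proof -
    have "power_sum s (?d * n) > 0" using that by (intro power_sum_pos) auto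
    then have "c * B powr (1 - r) \<le> c * power_sum s (?d * n) powr (1 - r)"
      using that r c(1) by (intro mult_left_mono powr_mono2') auto
    also have "\<dots> \<le> capacity TYPE('d) r n"
      using that c(2) by (intro capacity_ge) auto
    finally show ?thesis .
  qed
  consider "r < real ?d" | "r = real ?d" | "r > real ?d" by linarith
  then show ?thesis
  proof cases
    case 1
    then have "s > 1" using r by (simp add: s_def D)
    then obtain B where B: "B > 0" "\<And>N. power_sum s N \<le> B" using power_sum_bounded by blast
    have "c * B powr (1 - r) \<le> kappa TYPE('d) r n" if "n \<ge> 2" for n
      using cap[of n B] that B 1 by (simp add: kappa_def)
    then show ?thesis using c(1) B(1) by (intro exI[of _ "c * B powr (1 - r)"]) auto
  next
    case 2
    then have s: "s = 1" using r by (simp add: s_def D)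
    \<comment> \<open>Because \<open>ln n \<ge> ln 2\<close>, the constant \<open>1 + ln d\<close>
      is absorbed into a multiple of \<open>ln n\<close>; the final 1 accounts for
      \<open>ln n\<close> itself.\<close>
    define B where "B = (1 + ln (real ?d)) / ln 2 + 1"
    have d1: "real ?d \<ge> 1" by (simp add: Suc_le_eq)
    have B: "B > 0" using d1 by (simp add: B_def add_nonneg_pos)
    have "c * B powr (1 - r) \<le> kappa TYPE('d) r n" if n: "n \<ge> 2" for n
    proof -
      have ln: "ln (real n) > 0" "ln (real n) \<ge> ln 2" using n by auto
      have "power_sum s (?d * n) \<le> 1 + ln (real (?d * n))"
        unfolding s using n by (intro power_sum_1_le) auto
      also have "\<dots> = (1 + ln (real ?d)) / ln 2 * ln 2 + ln (real n)"
        using n by (simp add: ln_mult)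
      also have "\<dots> \<le> (1 + ln (real ?d)) / ln 2 * ln (real n) + ln (real n)"
        using ln d1 by (intro add_right_mono mult_left_mono) auto
      also have "\<dots> = B * ln (real n)" by (simp add: B_def algebra_simps)
      finally have "c * (B * ln (real n)) powr (1 - r) \<le> capacity TYPE('d) r n"
        using n by (intro cap) auto
      then have "ln (real n) ^ ?D * (c * (B * ln (real n)) powr (1 - r)) \<le> ln (real n) ^ ?D * capacity TYPE('d) r n"
        using ln by (intro mult_left_mono) auto
      moreover have "ln (real n) ^ ?D * (c * (B * ln (real n)) powr (1 - r)) = c * B powr (1 - r)"
      proof -
        have "ln (real n) ^ ?D = ln (real n) powr (r - 1)"
          using ln 2 by (simp add: D flip: powr_realpow)
        then have "ln (real n) ^ ?D * (c * (B * ln (real n)) powr (1 - r))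
            = c * B powr (1 - r) * (ln (real n) powr (r - 1 + (1 - r)))"
          using ln B by (simp only: powr_mult powr_add mult_ac less_imp_le)
        then show ?thesis using ln by simp
      qed
      ultimately have "c * B powr (1 - r) \<le> ln (real n) ^ ?D * capacity TYPE('d) r n" by (simp only:)
      then show ?thesis using 2 by (simp add: kappa_def)
    qed
    then show ?thesis using c(1) B by (intro exI[of _ "c * B powr (1 - r)"]) auto
  next
    case 3
    then have s: "0 \<le> s" "s < 1" using r by (auto simp: s_def D)
    have exponent: "(1 - s) * (1 - r) = real ?d - r"
      using r by (simp add: s_def D field_simps)
    \<comment> \<open>The power of d appears because the levels range up to
      \<open>d * n\<close>.\<close>
    define B where "B = real ?d powr (1 - s) / (1 - s)"
    have B: "B > 0" using s by (simp add: B_def)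
    have "c * B powr (1 - r) \<le> kappa TYPE('d) r n" if n: "n \<ge> 2" for n
    proof -
      have "power_sum s (?d * n) \<le> B * real n powr (1 - s)"
        using power_sum_le_powr[OF s, of "?d * n"] by (simp add: B_def powr_mult)
      then have "c * (B * real n powr (1 - s)) powr (1 - r) \<le> capacity TYPE('d) r n"
        using n by (intro cap) auto
      then have "real n powr (r - real ?d) * (c * (B * real n powr (1 - s)) powr (1 - r))
          \<le> real n powr (r - real ?d) * capacity TYPE('d) r n"
        by (intro mult_left_mono) auto
      moreover have "(B * real n powr (1 - s)) powr (1 - r) = B powr (1 - r) * real n powr (real ?d - r)"
        using B by (simp add: powr_mult powr_powr exponent)
      then have "real n powr (r - real ?d) * (c * (B * real n powr (1 - s)) powr (1 - r))
          = c * B powr (1 - r) * real n powr (r - real ?d + (real ?d - r))"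
        by (simp only: powr_add mult_ac)
      then have "real n powr (r - real ?d) * (c * (B * real n powr (1 - s)) powr (1 - r)) = c * B powr (1 - r)"
        using n by simp
      ultimately show ?thesis using 3 by (simp add: kappa_def)
    qed
    then show ?thesis using c(1) B by (intro exI[of _ "c * B powr (1 - r)"]) auto
  qed
qed

theorem theorem2p2:
  fixes r :: real
  assumes "r > 0"
  shows "\<exists>c C. 0 < c \<and> c \<le> C \<and> (\<forall>n\<ge>2. c \<le> kappa TYPE('d::finite) r n \<and> kappa TYPE('d) r n \<le> C)"
proof -
  obtain c where c: "c > 0" "\<forall>n\<ge>2. c \<le> kappa TYPE('d) r n"
    using kappa_lower[OF assms] by blast
  obtain C where C: "\<forall>n\<ge>2. kappa TYPE('d) r n \<le> C"
    using kappa_upper[OF assms] by blast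
  \<comment> \<open>Both bounds hold for a common value of \<open>kappa\<close>, for instance at
    \<open>n = 2\<close>.\<close>
  have "c \<le> C" using c(2) C by (meson order.refl order.trans)
  with c C show ?thesis by blast
qed

end
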